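(* Let $G$ be an arbitrary group, let $F$ be an arbitrary field, and let $L=\bigoplus_{g\in G}L_g$ be a $G$-graded Lie algebra over $F$ (not necessarily finite dimensional) which is graded simple. Then $\mathrm{Supp}\,L$ generates an abelian subgroup of $G$.
   Context: Let $G$ be a group (written multiplicatively) and $F$ a field. A Lie algebra $L$ over $F$ is $G$-graded if it is equipped with a vector space decomposition $L=\bigoplus_{g\in G}L_g$ such that $[L_g,L_h]\subseteq L_{gh}$ for all $g,h\in G$. An ideal $V\subseteq L$ is graded if $V=\bigoplus_{g\in G}(V\cap L_g)$. The support of the grading is $\mathrm{Supp}\,L=\{g\in G\mid L_g\neq 0\}$. A $G$-graded Lie algebra $L$ is graded simple if $[L,L]\neq 0$ and $L$ has no graded ideals other than $0$ and $L$. *)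

theory Defs
  imports Complex_Main "HOL-Algebra.Generated_Groups"
begin

text \<open>
  The field is the type \<open>'f\<close> and the (arbitrary-dimensional) Lie algebra is the type \<open>'v\<close>; the
  grading group is an arbitrary, not necessarily commutative, group in the sense of HOL-Algebra.
  Here \<^locale>\<open>vector_space\<close> is the locale of HOL's \<open>Vector_Spaces\<close>.
\<close>

locale lie_algebra = vector_space scale
  for scale :: "'f::field \<Rightarrow> 'v::ab_group_add \<Rightarrow> 'v" +
  fixes bracket :: "'v \<Rightarrow> 'v \<Rightarrow> 'v"
  assumes bracket_add_left: "bracket (x + y) z = bracket x z + bracket y z"
    and bracket_add_right: "bracket x (y + z) = bracket x y + bracket x z"
    and bracket_scale_left: "bracket (scale a x) y = scale a (bracket x y)"
    and bracket_scale_right: "bracket x (scale a y) = scale a (bracket x y)"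
    and bracket_self: "bracket x x = 0"
    and jacobi: "bracket x (bracket y z) + bracket y (bracket z x) + bracket z (bracket x y) = 0"

text \<open>
  Internal direct sum: every element of \<open>V\<close> has exactly one finitely supported decomposition
  into components. Families are required to vanish outside \<open>I\<close>, so that uniqueness is
  uniqueness on \<open>I\<close>.
\<close>

definition (in vector_space) internal_direct_sum :: "'i set \<Rightarrow> ('i \<Rightarrow> 'b set) \<Rightarrow> 'b set \<Rightarrow> bool"
  where "internal_direct_sum I W V \<longleftrightarrow>
    subspace V \<and> (\<forall>i\<in>I. subspace (W i) \<and> W i \<subseteq> V) \<and>
    (\<forall>v\<in>V. \<exists>!c. (\<forall>i\<in>I. c i \<in> W i) \<and> (\<forall>i. i \<notin> I \<longrightarrow> c i = 0) \<and>
       finite {i. c i \<noteq> 0} \<and> v = (\<Sum>i | c i \<noteq> 0. c i))"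

context lie_algebra
begin

text \<open>By anticommutativity there is no difference between left and right ideals.\<close>

definition lie_ideal :: "'v set \<Rightarrow> bool"
  where "lie_ideal V \<longleftrightarrow> subspace V \<and> (\<forall>x. \<forall>v\<in>V. bracket x v \<in> V)"

definition derived_algebra :: "'v set"
  where "derived_algebra = span {bracket x y |x y. True}"

end

text \<open>Only the values of \<open>L\<close> on \<^term>\<open>carrier G\<close> are relevant.\<close>

locale graded_lie_algebra = lie_algebra scale bracket + group G
  for scale :: "'f::field \<Rightarrow> 'v::ab_group_add \<Rightarrow> 'v"
    and bracket :: "'v \<Rightarrow> 'v \<Rightarrow> 'v"
    and G :: "('g, 'm) monoid_scheme" (structure) +
  fixes L :: "'g \<Rightarrow> 'v set"
  assumes decomposition: "internal_direct_sum (carrier G) L UNIV"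
    and bracket_component:
      "\<lbrakk>g \<in> carrier G; h \<in> carrier G; x \<in> L g; y \<in> L h\<rbrakk> \<Longrightarrow> bracket x y \<in> L (g \<otimes> h)"
begin

definition graded_ideal :: "'v set \<Rightarrow> bool"
  where "graded_ideal V \<longleftrightarrow>
    lie_ideal V \<and> internal_direct_sum (carrier G) (\<lambda>g. V \<inter> L g) V"

definition Supp :: "'g set"
  where "Supp = {g \<in> carrier G. L g \<noteq> {0}}"

definition graded_simple :: bool
  where "graded_simple \<longleftrightarrow>
    derived_algebra \<noteq> {0} \<and> (\<forall>V. graded_ideal V \<longrightarrow> V = {0} \<or> V = UNIV)"

end

end

theory Submission
  imports Defs
begin

text \<open>
  Let \<open>a \<noteq> 0\<close> be homogeneous of degree \<open>g\<close> and let \<open>H\<close> be the centralizer of \<open>g\<close>. Components of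
  non-commuting degrees annihilate each other by anticommutativity. Hence \<open>a\<close> lies in the span \<open>V\<close>
  of the homogeneous elements whose degree is in \<open>H\<close> and which are annihilated by every \<open>L k\<close> with
  \<open>k \<notin> H\<close>. By the Jacobi identity \<open>V\<close> is a graded ideal, so it is the whole algebra, and therefore
  the support is contained in \<open>H\<close>.
\<close>

section \<open>Internal direct sums and spans of subfamilies of their components\<close>

context vector_space
begin

lemma internal_direct_sum_unique:
  assumes "internal_direct_sum I W V" "v \<in> V"
    and "\<forall>i\<in>I. c i \<in> W i" "\<forall>i. i \<notin> I \<longrightarrow> c i = 0" "finite {i. c i \<noteq> 0}"
      "v = (\<Sum>i | c i \<noteq> 0. c i)"
    and "\<forall>i\<in>I. d i \<in> W i" "\<forall>i. i \<notin> I \<longrightarrow> d i = 0" "finite {i. d i \<noteq> 0}"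
      "v = (\<Sum>i | d i \<noteq> 0. d i)"
  shows "c = d"
proof -
  have "\<exists>!c. (\<forall>i\<in>I. c i \<in> W i) \<and> (\<forall>i. i \<notin> I \<longrightarrow> c i = 0) \<and>
       finite {i. c i \<noteq> 0} \<and> v = (\<Sum>i | c i \<noteq> 0. c i)"
    using assms(1,2) unfolding internal_direct_sum_def by blast
  then show ?thesis using assms(3-) by (elim ex1E) metis
qed

lemma internal_direct_sum_span:
  assumes V: "internal_direct_sum I W V"
  shows "span (\<Union>i\<in>I. W i) = V"
proof
  show "span (\<Union>i\<in>I. W i) \<subseteq> V"
    using V unfolding internal_direct_sum_def by (intro span_minimal) auto
  show "V \<subseteq> span (\<Union>i\<in>I. W i)"
  proof
    fix v assume "v \<in> V"
    then obtain c where c: "\<forall>i\<in>I. c i \<in> W i" "\<forall>i. i \<notin> I \<longrightarrow> c i = 0" "v = (\<Sum>i | c i \<noteq> 0. c i)"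
      using V unfolding internal_direct_sum_def by blast
    show "v \<in> span (\<Union>i\<in>I. W i)"
      unfolding c(3) using c(1,2) by (intro span_sum span_base) auto
  qed
qed

text \<open>This is the existence half of a decomposition into components: adding
  \<open>a *s x\<close> with \<open>x\<close> in \<open>T j\<close> changes only the coordinate at
  \<open>j\<close>.\<close>

lemma span_Union_decomposition:
  assumes T: "\<And>i. i \<in> I \<Longrightarrow> subspace (T i)" and v: "v \<in> span (\<Union>i\<in>I. T i)"
  shows "\<exists>c. (\<forall>i\<in>I. c i \<in> T i) \<and> (\<forall>i. i \<notin> I \<longrightarrow> c i = 0) \<and>
       finite {i. c i \<noteq> 0} \<and> v = (\<Sum>i | c i \<noteq> 0. c i)"
  using v
proof (induction rule: span_induct_alt)
  case base
  show ?case using T by (intro exI[of _ "\<lambda>_. 0"]) (auto simp: subspace_0)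
next
  case (step a x y)
  obtain c where c: "\<forall>i\<in>I. c i \<in> T i" "\<forall>i. i \<notin> I \<longrightarrow> c i = 0"
      "finite {i. c i \<noteq> 0}" "y = (\<Sum>i | c i \<noteq> 0. c i)"
    using step by blast
  obtain j where j: "j \<in> I" "x \<in> T j" using step by blast
  let ?d = "c(j := a *s x + c j)"
  \<comment> \<open>\<open>?A\<close> contains the supports of both \<open>c\<close> and
    \<open>?d\<close>. It can be larger than either: \<open>c j\<close> may be zero, and
    \<open>a *s x\<close> may cancel \<open>c j\<close>.\<close>
  let ?A = "insert j {i. c i \<noteq> 0}"
  have "?d i \<in> T i" if "i \<in> I" for i
    using that j c(1) T by (auto intro: subspace_add subspace_scale)
  moreover have "finite {i. ?d i \<noteq> 0}"
    by (rule finite_subset[of _ ?A]) (use c in auto)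
  moreover have "(\<Sum>i | ?d i \<noteq> 0. ?d i) = sum ?d ?A"
    by (rule sum.mono_neutral_left) (use c in auto)
  moreover have "sum ?d ?A = a *s x + sum c ?A"
    using c(3) by (simp add: sum.insert_remove add.assoc)
  moreover have "sum c ?A = y"
    unfolding c(4) by (rule sum.mono_neutral_right) (use c in auto)
  ultimately show ?case using c(2) j(1) by (intro exI[of _ ?d]) auto
qed

text \<open>A decomposition along \<open>T\<close> is also one along \<open>W\<close>, so uniqueness
  is inherited from \<open>V\<close>. The second claim says that the span acquires no new elements
  inside a single component; this later recovers homogeneous components from a span.\<close>

lemma
  assumes V: "internal_direct_sum I W V"
    and T: "\<And>i. i \<in> I \<Longrightarrow> subspace (T i)" "\<And>i. i \<in> I \<Longrightarrow> T i \<subseteq> W i"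
  shows internal_direct_sum_subfamily: "internal_direct_sum I T (span (\<Union>i\<in>I. T i))"
    and span_subfamily_Int: "\<And>i. i \<in> I \<Longrightarrow> span (\<Union>i\<in>I. T i) \<inter> W i = T i"
proof -
  let ?P = "\<lambda>W v c. (\<forall>i\<in>I. c i \<in> W i) \<and> (\<forall>i. i \<notin> I \<longrightarrow> c i = 0) \<and>
       finite {i. c i \<noteq> 0} \<and> v = (\<Sum>i | c i \<noteq> 0. c i)"
  have W: "subspace (W i)" "W i \<subseteq> V" if "i \<in> I" for i
    using V that unfolding internal_direct_sum_def by auto
  have uniq: "c = d" if "v \<in> V" "?P W v c" "?P W v d" for v c d
    using internal_direct_sum_unique[OF V that(1)] that(2,3) by blast
  have mono: "?P W v c" if "?P T v c" for v c
    using that T(2) by blast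
  have sub: "span (\<Union>i\<in>I. T i) \<subseteq> V"
    using V T(2) unfolding internal_direct_sum_def by (intro span_minimal) blast+
  have ex1: "\<exists>!c. ?P T v c" if "v \<in> span (\<Union>i\<in>I. T i)" for v
  proof (rule ex_ex1I)
    show "\<exists>c. ?P T v c" using span_Union_decomposition[OF T(1) that] by blast
    show "c = d" if "?P T v c" "?P T v d" for c d
      using uniq[OF _ mono[OF that(1)] mono[OF that(2)]] sub \<open>v \<in> span _\<close> by blast
  qed
  then show "internal_direct_sum I T (span (\<Union>i\<in>I. T i))"
    using T(1) unfolding internal_direct_sum_def by (auto intro: span_base)
  show "span (\<Union>i\<in>I. T i) \<inter> W i = T i" if i: "i \<in> I" for i
  proof
    show "T i \<subseteq> span (\<Union>i\<in>I. T i) \<inter> W i" using i T(2) by (auto intro: span_base)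
    show "span (\<Union>i\<in>I. T i) \<inter> W i \<subseteq> T i"
    proof
      fix v assume v: "v \<in> span (\<Union>i\<in>I. T i) \<inter> W i"
      obtain c where c: "?P T v c" using v ex1 by blast
      \<comment> \<open>An element of \<open>W i\<close> has the decomposition concentrated at
        \<open>i\<close>; by uniqueness it is the one along \<open>T\<close>, so its coordinate
        \<open>v\<close> lies in \<open>T i\<close>.\<close>
      let ?d = "(\<lambda>_. 0)(i := v)"
      have supp: "{j. ?d j \<noteq> 0} = (if v = 0 then {} else {i})" by auto
      have "?P W v ?d" unfolding supp using v i W(1) by (auto simp: subspace_0)
      then have "c = ?d" using uniq[OF _ mono[OF c]] v sub by blast
      then have "c i = v" by simp
      then show "v \<in> T i" using c i by blast
    qed
  qed
qed

end

section \<open>Consequences of bilinearity and the Jacobi identity\<close>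

context lie_algebra
begin

lemma bracket_zero_left [simp]: "bracket 0 y = 0"
  using bracket_add_left[of 0 0 y] by simp

lemma bracket_zero_right [simp]: "bracket x 0 = 0"
  using bracket_add_right[of x 0 0] by simp

lemma bracket_anticomm: "bracket x y = - bracket y x"
proof -
  have "bracket (x + y) (x + y) = bracket x y + bracket y x"
    unfolding bracket_add_left bracket_add_right by (simp add: bracket_self)
  then show ?thesis by (simp add: bracket_self eq_neg_iff_add_eq_0)
qed

lemma bracket_minus_right: "bracket x (- y) = - bracket x y"
  using bracket_add_right[of x y "- y"] by (simp add: minus_unique)

text \<open>This is the Jacobi identity in the form that bracketing with \<open>x\<close> is a
  derivation, obtained by anticommutativity.\<close>

lemma bracket_derivation:
  "bracket x (bracket y z) = bracket (bracket x y) z + bracket y (bracket x z)"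
proof -
  have "bracket x (bracket y z) - bracket y (bracket x z) - bracket (bracket x y) z = 0"
    using jacobi[of x y z] bracket_anticomm[of z x] bracket_anticomm[of z "bracket x y"]
    by (simp add: bracket_minus_right)
  then show ?thesis by (simp add: algebra_simps)
qed

text \<open>By bilinearity the ideal property can be tested on spanning sets: one induction extends
  it in the second argument, another in the first. With homogeneous spanning sets, only brackets of
  homogeneous elements remain to be checked.\<close>

lemma lie_ideal_span:
  assumes A: "span A = UNIV" and B: "\<And>x v. x \<in> A \<Longrightarrow> v \<in> B \<Longrightarrow> bracket x v \<in> span B"
  shows "lie_ideal (span B)"
  unfolding lie_ideal_def
proof (intro conjI allI ballI)
  have AB: "bracket x v \<in> span B" if "x \<in> A" "v \<in> span B" for x v
    using that(2)
    by (induction rule: span_induct_alt)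
      (use B[OF that(1)] in \<open>auto simp: bracket_add_right bracket_scale_right span_zero
        intro: span_add span_scale\<close>)
  fix x v assume v: "v \<in> span B"
  have "x \<in> span A" using A by simp
  then show "bracket x v \<in> span B"
    by (induction rule: span_induct_alt)
      (use AB[OF _ v] in \<open>auto simp: bracket_add_left bracket_scale_left span_zero
        intro: span_add span_scale\<close>)
qed simp

end

section \<open>Homogeneous components and non-commuting degrees\<close>

context graded_lie_algebra
begin

lemma subspace_component: "g \<in> carrier G \<Longrightarrow> subspace (L g)"
  using decomposition unfolding internal_direct_sum_def by blast

text \<open>Apply \<open>span_subfamily_Int\<close> to the subfamily that keeps \<open>L g\<close>
  and replaces all other components by zero: its span contains \<open>x\<close> and meets
  \<open>L h\<close> only in zero.\<close>

lemma components_disjoint: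
  assumes "g \<in> carrier G" "h \<in> carrier G" "g \<noteq> h" "x \<in> L g" "x \<in> L h"
  shows "x = 0"
proof -
  let ?T = "\<lambda>i. if i = g then L g else {0}"
  have "span (\<Union>i\<in>carrier G. ?T i) \<inter> L h = ?T h"
    by (rule span_subfamily_Int[OF decomposition])
      (use assms subspace_component in \<open>auto simp: subspace_0\<close>)
  moreover have "x \<in> span (\<Union>i\<in>carrier G. ?T i)"
    using assms by (intro span_base) auto
  ultimately show ?thesis using assms by auto
qed

text \<open>The bracket lies in \<open>L (g \<otimes> h)\<close> and, up to sign, in
  \<open>L (h \<otimes> g)\<close>. These are distinct components, so they meet only in
  zero.\<close>

lemma bracket_eq_zero_if_not_commute:
  assumes g: "g \<in> carrier G" "x \<in> L g" and h: "h \<in> carrier G" "y \<in> L h"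
    and gh: "g \<otimes> h \<noteq> h \<otimes> g"
  shows "bracket x y = 0"
proof -
  have "bracket x y \<in> L (h \<otimes> g)"
    using bracket_component[OF h(1) g(1) h(2) g(2)] subspace_neg[OF subspace_component]
      bracket_anticomm[of x y] g h by auto
  then show ?thesis
    using components_disjoint[OF _ _ gh] bracket_component g h by blast
qed

section \<open>Centralizers and the graded ideal attached to a subgroup\<close>

definition centralizer :: "'g \<Rightarrow> 'g set"
  where "centralizer g = {h \<in> carrier G. h \<otimes> g = g \<otimes> h}"

lemma centralizer_subgroup:
  assumes g: "g \<in> carrier G"
  shows "subgroup (centralizer g) G"
proof (rule subgroupI)
  show "centralizer g \<noteq> {}" using g unfolding centralizer_def by auto
  fix a assume a: "a \<in> centralizer g"
  then have ac: "a \<in> carrier G" and ag: "a \<otimes> g = g \<otimes> a" unfolding centralizer_def by auto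
  have "a \<otimes> (g \<otimes> inv a) = g"
    using g ac by (simp add: m_assoc[symmetric] ag) (simp add: m_assoc)
  then have "inv a \<otimes> g = g \<otimes> inv a" using g ac by (simp add: inv_solve_left')
  then show "inv a \<in> centralizer g" using ac unfolding centralizer_def by simp
next
  fix a b assume "a \<in> centralizer g" "b \<in> centralizer g"
  then show "a \<otimes> b \<in> centralizer g"
    using g unfolding centralizer_def by (simp add: m_assoc) (metis m_assoc)
qed (auto simp: centralizer_def)

text \<open>The disjunct \<open>u = 0\<close> makes the component zero for degrees outside
  \<open>H\<close>, so that the family is indexed by all of \<open>carrier G\<close>, like
  \<open>L\<close> itself.\<close>

definition annihilated_component :: "'g set \<Rightarrow> 'g \<Rightarrow> 'v set"
  where "annihilated_component H h =
    {u \<in> L h. (h \<in> H \<or> u = 0) \<and> (\<forall>k\<in>carrier G - H. \<forall>x\<in>L k. bracket x u = 0)}"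

lemma annihilated_component_subspace:
  assumes "h \<in> carrier G"
  shows "subspace (annihilated_component H h)"
  using subspace_component[OF assms] unfolding annihilated_component_def subspace_def
  by (auto simp: bracket_add_right bracket_scale_right)

text \<open>For \<open>x\<close> of degree \<open>k\<close> outside \<open>H\<close>, expand
  \<open>bracket x (bracket y u)\<close> by the derivation rule. Since \<open>h\<close> is in
  \<open>H\<close>, the degree \<open>k \<otimes> h\<close> of \<open>bracket x y\<close> is again
  outside \<open>H\<close>, so both terms vanish.\<close>

lemma bracket_annihilated_component:
  assumes H: "subgroup H G" and h: "h \<in> H" "y \<in> L h"
    and j: "j \<in> H" "u \<in> annihilated_component H j"
  shows "bracket y u \<in> annihilated_component H (h \<otimes> j)"
proof -
  have car: "h \<in> carrier G" "j \<in> carrier G" using H h j subgroup.mem_carrier by metis+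
  have "bracket x (bracket y u) = 0" if k: "k \<in> carrier G - H" and x: "x \<in> L k" for k x
  proof -
    have "k \<otimes> h \<notin> H"
    proof
      assume "k \<otimes> h \<in> H"
      then have "k \<otimes> h \<otimes> inv h \<in> H"
        using H h by (simp add: subgroup.m_closed subgroup.m_inv_closed)
      then show False using k car by (simp add: m_assoc)
    qed
    moreover have "bracket x y \<in> L (k \<otimes> h)"
      using bracket_component k car x h by blast
    ultimately have "bracket (bracket x y) u = 0" "bracket x u = 0"
      using j k x car unfolding annihilated_component_def by auto
    then show ?thesis by (simp add: bracket_derivation[of x y u])
  qed
  then show ?thesis
    using H h j car bracket_component subgroup.m_closed
    unfolding annihilated_component_def by auto
qed

lemma graded_ideal_annihilated:
  assumes H: "subgroup H G"
  shows "graded_ideal (span (\<Union>h\<in>carrier G. annihilated_component H h))" (is "graded_ideal ?V")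
proof -
  let ?T = "annihilated_component H"
  have sub: "?T h \<subseteq> L h" for h unfolding annihilated_component_def by auto
  note T = decomposition annihilated_component_subspace sub
  have "lie_ideal ?V"
  proof (rule lie_ideal_span[OF internal_direct_sum_span[OF decomposition]])
    fix x v assume "x \<in> (\<Union>g\<in>carrier G. L g)" "v \<in> (\<Union>h\<in>carrier G. ?T h)"
    then obtain k h where kh: "k \<in> carrier G" "x \<in> L k" "h \<in> carrier G" "v \<in> ?T h" by blast
    show "bracket x v \<in> ?V"
    proof (cases "k \<in> H \<and> h \<in> H")
      case True
      then show ?thesis
        using bracket_annihilated_component[OF H _ kh(2) _ kh(4)] kh by (intro span_base) blast
    next
      \<comment> \<open>If \<open>k\<close> is outside \<open>H\<close>, then \<open>x\<close>
        annihilates \<open>v\<close> by definition; if \<open>h\<close> is outside \<open>H\<close>,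
        then \<open>v\<close> is already zero.\<close>
      case False
      then have "bracket x v = 0" using kh unfolding annihilated_component_def by auto
      then show ?thesis by (simp add: span_zero)
    qed
  qed
  \<comment> \<open>On \<open>carrier G\<close> the intersections \<open>?V \<inter> L g\<close> are
    exactly the \<open>?T g\<close>, so gradedness is the direct sum of the subfamily.\<close>
  moreover have "internal_direct_sum (carrier G) (\<lambda>g. ?V \<inter> L g) ?V"
    using internal_direct_sum_subfamily[OF T] span_subfamily_Int[OF T]
    unfolding internal_direct_sum_def by simp
  ultimately show ?thesis unfolding graded_ideal_def by blast
qed

section \<open>The support and the subgroup it generates\<close>

lemma Supp_subset_centralizer:
  assumes simple: graded_simple and g: "g \<in> Supp"
  shows "Supp \<subseteq> centralizer g"
proof
  fix k assume k: "k \<in> Supp"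
  let ?T = "annihilated_component (centralizer g)"
  let ?V = "span (\<Union>h\<in>carrier G. ?T h)"
  have gc: "g \<in> carrier G" and kc: "k \<in> carrier G" using g k unfolding Supp_def by auto
  obtain a where a: "a \<in> L g" "a \<noteq> 0"
    using g subspace_0[OF subspace_component[OF gc]] unfolding Supp_def by blast
  \<comment> \<open>A degree outside the centralizer does not commute with \<open>g\<close>, so its
    component annihilates \<open>a\<close>; and \<open>g\<close> commutes with itself.\<close>
  have "a \<in> ?T g"
    using a gc bracket_eq_zero_if_not_commute[OF _ _ gc a(1)]
    unfolding annihilated_component_def centralizer_def by auto
  then have "a \<in> ?V" using gc by (intro span_base) blast
  then have "?V = UNIV"
    using simple a(2) graded_ideal_annihilated[OF centralizer_subgroup[OF gc]]
    unfolding graded_simple_def by auto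
  moreover have "?V \<inter> L k = ?T k"
    by (rule span_subfamily_Int[OF decomposition annihilated_component_subspace _ kc])
      (auto simp: annihilated_component_def)
  \<comment> \<open>A nonzero element of \<open>?T k\<close> exists only when \<open>k\<close> lies
    in the centralizer.\<close>
  ultimately have "L k = ?T k" by simp
  moreover obtain b where "b \<in> L k" "b \<noteq> 0"
    using k subspace_0[OF subspace_component[OF kc]] unfolding Supp_def by blast
  ultimately show "k \<in> centralizer g" unfolding annihilated_component_def by auto
qed

text \<open>The centralizer of an element is a subgroup, so it contains \<open>generate G S\<close>
  once it contains \<open>S\<close>. This is used twice: first for elements of \<open>S\<close>,
  then, commuting being symmetric, for arbitrary elements of \<open>generate G S\<close>.\<close>

lemma comm_group_generate:
  assumes S: "S \<subseteq> carrier G" and comm: "\<And>g. g \<in> S \<Longrightarrow> S \<subseteq> centralizer g"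
  shows "comm_group (G\<lparr>carrier := generate G S\<rparr>)"
proof -
  have sub: "generate G S \<subseteq> centralizer g" if "g \<in> carrier G" "S \<subseteq> centralizer g" for g
    using generate_subgroup_incl[OF that(2) centralizer_subgroup[OF that(1)]] .
  have car: "generate G S \<subseteq> carrier G" using generate_incl[OF S] .
  have "S \<subseteq> centralizer x" if x: "x \<in> generate G S" for x
  proof
    fix g assume g: "g \<in> S"
    then have "x \<in> centralizer g" using sub comm S x by blast
    then show "g \<in> centralizer x" using g S unfolding centralizer_def by auto
  qed
  then have "generate G S \<subseteq> centralizer x" if "x \<in> generate G S" for x
    using sub car that by blast
  then have "x \<otimes> y = y \<otimes> x" if "x \<in> generate G S" "y \<in> generate G S" for x y
    using that unfolding centralizer_def by blast
  then show ?thesis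
    using subgroup.subgroup_is_group[OF generate_is_subgroup[OF S]] is_group
    by (intro group.group_comm_groupI) auto
qed

end

theorem proposition2p3:
  fixes G :: "('g, 'm) monoid_scheme"
    and scale :: "'f::field \<Rightarrow> 'v::ab_group_add \<Rightarrow> 'v"
    and bracket :: "'v \<Rightarrow> 'v \<Rightarrow> 'v"
    and L :: "'g \<Rightarrow> 'v set"
  assumes "graded_lie_algebra scale bracket G L"
    and "graded_lie_algebra.graded_simple scale bracket G L"
  shows "comm_group (G\<lparr>carrier := generate G (graded_lie_algebra.Supp G L)\<rparr>)"
proof -
  interpret graded_lie_algebra scale bracket G L by fact
  show ?thesis
    using Supp_subset_centralizer[OF assms(2)]
    by (intro comm_group_generate) (auto simp: Supp_def)
qed

end
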